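(* Let $n$ be a positive integer and let $H\in\mathfrak{sl}_n(\mathbb{C})$ be a semisimple element which is $\mathrm{Ad}_{\mathrm{SL}_n(\mathbb{C})}$-real. Then $H$ is strongly $\mathrm{Ad}_{\mathrm{SL}_n(\mathbb{C})}$-real if and only if either $0$ is an eigenvalue of $H$ or $n\not\equiv 2 \pmod 4$.
   Context: $\mathrm{SL}_n(\mathbb{C})=\{g\in\mathrm{GL}_n(\mathbb{C}) : \det g=1\}$, with Lie algebra $\mathfrak{sl}_n(\mathbb{C})=\{z\in \mathrm{M}_n(\mathbb{C}) : \mathrm{tr}(z)=0\}$. An element of $\mathfrak{sl}_n(\mathbb{C})$ is semisimple if it is diagonalizable as a complex matrix. For a Lie group $G$ with Lie algebra $\mathfrak{g}$, an element $X\in\mathfrak{g}$ is called $\mathrm{Ad}_G$-real if $-X=\mathrm{Ad}(g)X$ for some $g\in G$. An $\mathrm{Ad}_G$-real element $X$ is called strongly $\mathrm{Ad}_G$-real if $-X=\mathrm{Ad}(\tau)X$ for some $\tau\in G$ with $\tau^2=\mathrm{Id}$. For a linear Lie group, $\mathrm{Ad}(g)X=gXg^{-1}$. *)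

theory Defs
  imports
    "HOL-Number_Theory.Cong"
    "Jordan_Normal_Form.Char_Poly"
    "Jordan_Normal_Form.Gauss_Jordan_Elimination"
begin

definition trace :: "'a :: comm_monoid_add mat \<Rightarrow> 'a" where
  "trace A = (\<Sum>i<dim_row A. A $$ (i, i))"

definition GL :: "nat \<Rightarrow> complex mat set" where
  "GL n = {g \<in> carrier_mat n n. invertible_mat g}"

definition SL :: "nat \<Rightarrow> complex mat set" where
  "SL n = {g \<in> GL n. det g = 1}"

definition sl :: "nat \<Rightarrow> complex mat set" where
  "sl n = {z \<in> carrier_mat n n. trace z = 0}"

definition semisimple :: "complex mat \<Rightarrow> bool" where
  "semisimple X \<longleftrightarrow> (\<exists>D. diagonal_mat D \<and> similar_mat X D)"

text \<open>The library's \<open>mat_inverse\<close> returns an option, which is \<open>None\<close> on singular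
  matrices, so \<open>Ad\<close> is only meaningful at invertible \<open>g\<close>. The lemma \<open>Ad_eq\<close> below
  confirms that it is conjugation there.\<close>

definition Ad :: "complex mat \<Rightarrow> complex mat \<Rightarrow> complex mat" where
  "Ad g X = g * X * the (mat_inverse g)"

definition Ad_real :: "complex mat set \<Rightarrow> complex mat \<Rightarrow> bool" where
  "Ad_real G X \<longleftrightarrow> (\<exists>g\<in>G. - X = Ad g X)"

definition strongly_Ad_real :: "complex mat set \<Rightarrow> complex mat \<Rightarrow> bool" where
  "strongly_Ad_real G X \<longleftrightarrow>
     Ad_real G X \<and> (\<exists>\<tau>\<in>G. \<tau> * \<tau> = 1\<^sub>m (dim_row \<tau>) \<and> - X = Ad \<tau> X)"

lemma Ad_eq:
  assumes g: "g \<in> carrier_mat n n" and h: "h \<in> carrier_mat n n"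
    and gh: "g * h = 1\<^sub>m n" and hg: "h * g = 1\<^sub>m n"
  shows "Ad g X = g * X * h"
proof -
  have "g \<in> Units (ring_mat TYPE(complex) n ())"
    using g h gh hg by (auto simp: Units_def ring_mat_simps)
  then obtain k where k: "mat_inverse g = Some k"
    using mat_inverse(1)[OF g, where b = "()"] by (cases "mat_inverse g") auto
  with mat_inverse(2)[OF g k] have *: "k * g = 1\<^sub>m n" "k \<in> carrier_mat n n" by auto
  have "k = k * (g * h)" using * gh by simp
  also have "\<dots> = (k * g) * h" using assoc_mult_mat[OF *(2) g h] by simp
  also have "\<dots> = h" using * h by simp
  finally show ?thesis by (simp add: Ad_def k)
qed

end

theory Submission
  imports
    Defs
    "HOL-Combinatorics.Permutations"
    "Jordan_Normal_Form.Schur_Decomposition"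
begin

text \<open>
  Write \<open>-H = \<tau> H \<tau>\<inverse>\<close> as \<open>\<tau> H = - H \<tau>\<close>. The question is which determinants an
  involution \<open>\<tau>\<close> anticommuting with \<open>H\<close> can have.

  If \<open>H\<close> is invertible, there is no choice. Conjugating \<open>\<tau>\<close> by \<open>H\<close> gives \<open>-\<tau>\<close>, so
  \<open>\<tau>\<close> has trace \<open>0\<close> (\<open>anticommuting_trace_zero\<close>). The eigenvalues of an involution are
  \<open>\<plusminus>1\<close>, so trace \<open>0\<close> means that both signs occur equally often, \<open>n\<close> is even and
  \<open>det \<tau> = (-1)\<^bsup>n/2\<^esup>\<close> (\<open>involution_trace_zero_det\<close>). This is \<open>1\<close> exactly when \<open>n\<close> is
  divisible by \<open>4\<close>. Hence the case \<open>n \<equiv> 2\<close> modulo \<open>4\<close> is impossible, and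
  in the other cases any anticommuting involution at all has determinant \<open>1\<close>.

  It remains to produce an anticommuting involution, and to correct its determinant when
  \<open>0\<close> is an eigenvalue. Diagonalize \<open>H\<close>. Since \<open>H\<close> is similar to \<open>-H\<close>, the eigenvalues
  \<open>c\<close> and \<open>-c\<close> have the same multiplicity, so some permutation of the indices that is its own
  inverse negates the diagonal entries and fixes every index with entry \<open>0\<close>
  (\<open>negating_involution\<close>). Its permutation matrix anticommutes with the diagonal matrix. If an
  entry is \<open>0\<close>, its index is fixed, and changing the sign of the corresponding \<open>1\<close> on
  the diagonal of the permutation matrix reverses the determinant without affecting the
  other properties (\<open>diagonal_anticommuting_involution\<close>).
\<close>

section \<open>Conjugation to the negative as anticommutation\<close>

lemma GL_inverse:
  assumes "g \<in> GL n"
  obtains h where "h \<in> carrier_mat n n" "g * h = 1\<^sub>m n" "h * g = 1\<^sub>m n"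
proof -
  have g: "g \<in> carrier_mat n n" and inv: "invertible_mat g"
    using assms by (auto simp: GL_def)
  from inv obtain h where 1: "g * h = 1\<^sub>m (dim_row g)" and 2: "h * g = 1\<^sub>m (dim_row h)"
    by (auto simp: invertible_mat_def inverts_mat_def)
  have "dim_col h = dim_row g" using arg_cong[OF 1, of dim_col] by simp
  moreover have "dim_row h = dim_col g" using arg_cong[OF 2, of dim_col] by simp
  ultimately show ?thesis using that[of h] 1 2 g by auto
qed

lemma mem_SL_iff: "g \<in> SL n \<longleftrightarrow> g \<in> carrier_mat n n \<and> det g = 1"
proof
  assume g: "g \<in> carrier_mat n n \<and> det g = 1"
  then have "g \<in> Units (ring_mat TYPE(complex) n ())"
    by (intro det_non_zero_imp_unit) auto
  then obtain h where "h \<in> carrier_mat n n" "h * g = 1\<^sub>m n" "g * h = 1\<^sub>m n"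
    by (auto simp: Units_def ring_mat_simps)
  then have "invertible_mat g"
    using g by (auto simp: invertible_mat_def inverts_mat_def intro!: exI[of _ h])
  with g show "g \<in> SL n" by (simp add: SL_def GL_def)
qed (simp add: SL_def GL_def)

text \<open>Trading conjugation for anticommutation removes the inverse of \<open>g\<close>, so that the
  condition can be checked entry by entry on explicit matrices.\<close>

lemma uminus_eq_Ad_iff:
  assumes g: "g \<in> GL n" and X: "X \<in> carrier_mat n n"
  shows "- X = Ad g X \<longleftrightarrow> g * X = - (X * g)"
proof -
  have gc: "g \<in> carrier_mat n n" using g by (simp add: GL_def)
  obtain h where h: "h \<in> carrier_mat n n" "g * h = 1\<^sub>m n" "h * g = 1\<^sub>m n"
    using GL_inverse[OF g] .
  note Ad = Ad_eq[OF gc h]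
  have gX: "g * X \<in> carrier_mat n n" and Xg: "X * g \<in> carrier_mat n n" using gc X by auto
  show ?thesis
  proof
    assume "- X = Ad g X"
    then have "- X * g = (g * X * h) * g" by (simp add: Ad)
    also have "\<dots> = g * X" using assoc_mult_mat[OF gX h(1) gc] h(3) right_mult_one_mat[OF gX] by simp
    finally show "g * X = - (X * g)" using gc X by simp
  next
    assume "g * X = - (X * g)"
    then have "Ad g X = - (X * g) * h" by (simp add: Ad)
    also have "\<dots> = - (X * g * h)" using gc X h by simp
    also have "\<dots> = - X" using assoc_mult_mat[OF X gc h(1)] h(2) right_mult_one_mat[OF X] by simp
    finally show "- X = Ad g X" by simp
  qed
qed

lemma strongly_Ad_real_SL_iff:
  assumes X: "X \<in> carrier_mat n n"
  shows "strongly_Ad_real (SL n) X \<longleftrightarrow>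
    (\<exists>\<tau>\<in>carrier_mat n n. det \<tau> = 1 \<and> \<tau> * \<tau> = 1\<^sub>m n \<and> \<tau> * X = - (X * \<tau>))"
proof -
  have "\<tau> * \<tau> = 1\<^sub>m (dim_row \<tau>) \<and> - X = Ad \<tau> X \<longleftrightarrow> \<tau> * \<tau> = 1\<^sub>m n \<and> \<tau> * X = - (X * \<tau>)"
    if "\<tau> \<in> SL n" for \<tau>
    using that uminus_eq_Ad_iff[OF _ X, of \<tau>] by (auto simp: SL_def GL_def)
  then show ?thesis
    unfolding strongly_Ad_real_def Ad_real_def Bex_def by (metis mem_SL_iff)
qed

lemma conj_mult_mat:
  fixes P A B Q :: "'a :: comm_ring_1 mat"
  assumes c: "P \<in> carrier_mat n n" "A \<in> carrier_mat n n" "B \<in> carrier_mat n n"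
      "Q \<in> carrier_mat n n"
    and QP: "Q * P = 1\<^sub>m n"
  shows "(P * A * Q) * (P * B * Q) = P * (A * B) * Q"
proof -
  have "(P * A * Q) * (P * B * Q) = P * A * ((Q * P) * B) * Q"
    using c by (simp add: assoc_mult_mat[of _ n n _ n _ n])
  also have "\<dots> = P * A * B * Q" unfolding QP using c by simp
  also have "\<dots> = P * (A * B) * Q" using c by (simp add: assoc_mult_mat[of _ n n _ n _ n])
  finally show ?thesis .
qed

section \<open>The determinant of an involution of trace zero\<close>

lemma trace_mult_comm:
  fixes A B :: "'a :: comm_semiring_0 mat"
  assumes "A \<in> carrier_mat n m" "B \<in> carrier_mat m n"
  shows "trace (A * B) = trace (B * A)"
proof -
  have "trace (A * B) = (\<Sum>i<n. \<Sum>j<m. A $$ (i, j) * B $$ (j, i))"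
    using assms by (simp add: trace_def scalar_prod_def atLeast0LessThan)
  also have "\<dots> = (\<Sum>j<m. \<Sum>i<n. B $$ (j, i) * A $$ (i, j))"
    by (subst sum.swap) (simp add: mult.commute)
  also have "\<dots> = trace (B * A)"
    using assms by (simp add: trace_def scalar_prod_def atLeast0LessThan)
  finally show ?thesis .
qed

lemma trace_similar:
  fixes A B :: "'a :: comm_ring_1 mat"
  assumes "similar_mat A B"
  shows "trace A = trace B"
proof -
  from similar_matD[OF assms] obtain n P Q where
    c: "A \<in> carrier_mat n n" "B \<in> carrier_mat n n" "P \<in> carrier_mat n n" "Q \<in> carrier_mat n n"
    and QP: "Q * P = 1\<^sub>m n" and A: "A = P * B * Q"
    by auto
  have "trace A = trace (Q * (P * B))"
    unfolding A using c by (intro trace_mult_comm) auto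
  also have "Q * (P * B) = B"
    using c QP by (simp flip: assoc_mult_mat)
  finally show ?thesis .
qed

text \<open>The diagonal of a product of upper triangular matrices is the entrywise product of the
  diagonals, so each diagonal entry of \<open>B\<close> squares to \<open>1\<close>.\<close>

lemma upper_triangular_involution_diag:
  fixes B :: "'a :: idom mat"
  assumes B: "B \<in> carrier_mat n n" and ut: "upper_triangular B" and inv: "B * B = 1\<^sub>m n"
    and i: "i < n"
  shows "B $$ (i, i) = 1 \<or> B $$ (i, i) = -1"
proof -
  have "1 = (B * B) $$ (i, i)" using inv i by simp
  also have "\<dots> = (\<Sum>j\<in>{0..<n}. B $$ (i, j) * B $$ (j, i))"
    using B i by (simp add: scalar_prod_def)
  also have "\<dots> = (\<Sum>j\<in>{i}. B $$ (i, j) * B $$ (j, i))"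
  proof (rule sum.mono_neutral_right)
    show "\<forall>j\<in>{0..<n} - {i}. B $$ (i, j) * B $$ (j, i) = 0"
    proof
      fix j assume "j \<in> {0..<n} - {i}"
      then consider "j < i" | "i < j" "j < n" by force
      then show "B $$ (i, j) * B $$ (j, i) = 0"
        using upper_triangularD[OF ut] B i by cases auto
    qed
  qed (use i in auto)
  finally show ?thesis by (simp add: square_eq_1_iff)
qed

text \<open>A Schur triangulation reduces this to counting signs: the diagonal consists of entries
  \<open>1\<close> and \<open>-1\<close>, the trace is the difference of their numbers, and the determinant is \<open>-1\<close>
  to the number of entries \<open>-1\<close>.\<close>

lemma involution_trace_zero_det:
  fixes T :: "complex mat"
  assumes T: "T \<in> carrier_mat n n" and inv: "T * T = 1\<^sub>m n" and tr: "trace T = 0"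
  shows "even n" and "det T = (-1) ^ (n div 2)"
proof -
  obtain es where "char_poly T = (\<Prod>a\<leftarrow>es. [:- a, 1:])"
    using char_poly_factorized[OF T] by blast
  then obtain B where B: "B \<in> carrier_mat n n" and ut: "upper_triangular B"
    and sim: "similar_mat T B"
    using schur_decomposition_exists[OF T] by blast
  from similar_mat_sym[OF sim] obtain P Q where wit: "similar_mat_wit B T P Q"
    unfolding similar_mat_def by blast
  have "B * B = 1\<^sub>m n"
  proof -
    note w = similar_mat_witD2[OF B wit]
    show ?thesis
      using conj_mult_mat[OF w(6,5,5,7) w(2)] w by (simp add: inv)
  qed
  note diag = upper_triangular_involution_diag[OF B ut this]
  define Pos where "Pos = {i\<in>{..<n}. B $$ (i, i) = 1}"
  define Neg where "Neg = {i\<in>{..<n}. B $$ (i, i) = -1}"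
  have split: "{..<n} = Pos \<union> Neg" "Pos \<inter> Neg = {}" and fin: "finite Pos" "finite Neg"
    using diag by (auto simp: Pos_def Neg_def)
  have "trace B = (\<Sum>i\<in>Pos. B $$ (i, i)) + (\<Sum>i\<in>Neg. B $$ (i, i))"
    unfolding trace_def using B split fin by (simp flip: sum.union_disjoint)
  also have "\<dots> = of_nat (card Pos) - of_nat (card Neg)"
    by (simp add: Pos_def Neg_def)
  finally have eq: "card Pos = card Neg"
    using trace_similar[OF sim] tr by simp
  have n: "n = card Pos + card Neg"
    using card_Un_disjoint[OF fin split(2)] split(1) by (metis card_lessThan)
  show "even n" using n eq by simp
  have "det B = (\<Prod>i<n. B $$ (i, i))"
    using det_upper_triangular[OF ut B] B by (simp add: prod_list_diag_prod atLeast0LessThan)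
  also have "\<dots> = (\<Prod>i\<in>Pos. B $$ (i, i)) * (\<Prod>i\<in>Neg. B $$ (i, i))"
    unfolding split(1) using split fin by (simp add: prod.union_disjoint)
  also have "\<dots> = (-1) ^ card Neg"
    by (simp add: Pos_def Neg_def)
  finally show "det T = (-1) ^ (n div 2)"
    using det_similar[OF sim] n eq by simp
qed

text \<open>The matrix \<open>T\<close> is similar to its negative: \<open>X\<inverse> T X = - T\<close>.\<close>

lemma anticommuting_trace_zero:
  fixes T X :: "complex mat"
  assumes T: "T \<in> carrier_mat n n" and X: "X \<in> carrier_mat n n"
    and anti: "T * X = - (X * T)" and nz: "det X \<noteq> 0"
  shows "trace T = 0"
proof -
  have "X \<in> Units (ring_mat TYPE(complex) n ())"
    using X nz by (rule det_non_zero_imp_unit)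
  then obtain K where K: "K \<in> carrier_mat n n" "K * X = 1\<^sub>m n" "X * K = 1\<^sub>m n"
    by (auto simp: Units_def ring_mat_simps)
  have "trace T = trace (T * X * K)"
    using T X K by simp
  also have "\<dots> = trace (K * (T * X))"
    using T X K by (intro trace_mult_comm) auto
  also have "K * (T * X) = - (K * X * T)"
    unfolding anti using T X K(1) by simp
  also have "trace \<dots> = - trace T"
    using T K by (simp add: trace_def sum_negf)
  finally show ?thesis by simp
qed

section \<open>Eigenvalue multiplicities and involutive pairings\<close>

lemma proots_char_poly_upper_triangular:
  fixes A :: "'a :: idom mat"
  assumes A: "A \<in> carrier_mat n n" and ut: "upper_triangular A"
  shows "proots (char_poly A) = mset (diag_mat A)"
proof -
  have "proots (\<Prod>a\<leftarrow>xs. [:- a, 1:]) = mset xs" for xs :: "'a list"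
  proof (induction xs)
    case (Cons a xs)
    have "(\<Prod>a\<leftarrow>xs. [:- a, 1:]) \<noteq> 0" by (auto simp: prod_list_zero_iff)
    then have "proots ([:- a, 1:] * (\<Prod>a\<leftarrow>xs. [:- a, 1:]))
        = proots [:- a, 1:] + proots (\<Prod>a\<leftarrow>xs. [:- a, 1:])"
      by (intro proots_mult) auto
    with Cons show ?case by (simp del: mult_pCons_left)
  qed simp
  then show ?thesis by (simp add: char_poly_upper_triangular[OF A ut])
qed

text \<open>Both diagonals list the roots of the common characteristic polynomial with their
  multiplicities, so one is a rearrangement of the other.\<close>

lemma diagonal_similar_permutation:
  fixes A B :: "'a :: idom mat"
  assumes sim: "similar_mat A B" and A: "A \<in> carrier_mat n n"
    and diag: "diagonal_mat A" "diagonal_mat B"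
  obtains f where "f permutes {..<n}" "\<And>i. i < n \<Longrightarrow> A $$ (i, i) = B $$ (f i, f i)"
proof -
  have B: "B \<in> carrier_mat n n" using similar_matD[OF sim] A by auto
  have ut: "upper_triangular A" "upper_triangular B"
    using diag A B by (auto simp: diagonal_mat_def upper_triangular_def)
  have "mset (diag_mat A) = mset (diag_mat B)"
    using char_poly_similar[OF sim] proots_char_poly_upper_triangular[OF A ut(1)]
      proots_char_poly_upper_triangular[OF B ut(2)] by simp
  then obtain f where f: "f permutes {..<length (diag_mat B)}"
      "permute_list f (diag_mat B) = diag_mat A"
    by (rule mset_eq_permutation)
  have len: "length (diag_mat B) = n" "length (diag_mat A) = n"
    using A B by (auto simp: diag_mat_def)
  have "A $$ (i, i) = B $$ (f i, f i)" if "i < n" for i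
  proof -
    have fi: "f i < n" using permutes_in_image[OF f(1), of i] that by (simp add: len)
    have "diag_mat A ! i = diag_mat B ! f i"
      using permute_list_nth[OF f(1), of i] f(2) that by (simp add: len)
    then show ?thesis using that fi A B by (simp add: diag_mat_def)
  qed
  with f(1) show ?thesis using that by (simp add: len)
qed

text \<open>The permutation \<open>f\<close> exchanges the values \<open>c\<close> and \<open>-c\<close> but need not be its own inverse.
  It becomes so by keeping \<open>f\<close> on one half only: choose one of \<open>c\<close> and \<open>-c\<close> for every
  \<open>c \<noteq> 0\<close>, use \<open>f\<close> to go from the chosen values to the others and \<open>f\<inverse>\<close> to come back.\<close>

lemma negating_involution:
  fixes d :: "'b \<Rightarrow> complex"
  assumes f: "f permutes S" and neg: "\<And>i. i \<in> S \<Longrightarrow> d (f i) = - d i"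
  obtains \<sigma> where "\<And>i. i \<in> S \<Longrightarrow> \<sigma> i \<in> S" "\<And>i. i \<in> S \<Longrightarrow> \<sigma> (\<sigma> i) = i"
    "\<And>i. i \<in> S \<Longrightarrow> d (\<sigma> i) = - d i" "\<And>i. d i = 0 \<Longrightarrow> \<sigma> i = i"
proof -
  \<comment> \<open>A half-plane, with half of its boundary line, contains exactly one of \<open>z\<close> and \<open>-z\<close> for \<open>z \<noteq> 0\<close>.\<close>
  define pos where "pos z \<longleftrightarrow> Re z > 0 \<or> Re z = 0 \<and> Im z > 0" for z
  have pos: "pos z \<or> pos (- z)" if "z \<noteq> 0" for z
    using that by (auto simp: pos_def complex_eq_iff)
  have npos: "\<not> (pos z \<and> pos (- z))" "\<not> pos 0" for z
    by (auto simp: pos_def)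
  define \<sigma> where "\<sigma> i = (if pos (d i) then f i else if pos (- d i) then Hilbert_Choice.inv f i else i)" for i
  have invS: "Hilbert_Choice.inv f i \<in> S" if "i \<in> S" for i
    using permutes_in_image[OF permutes_inv[OF f]] that by simp
  have neginv: "d (Hilbert_Choice.inv f i) = - d i" if "i \<in> S" for i
    using neg[OF invS[OF that]] permutes_inverses(1)[OF f, of i] by simp
  show ?thesis
  proof
    fix i assume i: "i \<in> S"
    show "\<sigma> i \<in> S"
      using i invS permutes_in_image[OF f] by (simp add: \<sigma>_def)
    show "\<sigma> (\<sigma> i) = i"
      using npos(1)[of "d i"] npos(2) by (auto simp: \<sigma>_def neg neginv i permutes_inverses[OF f])
    show "d (\<sigma> i) = - d i"
      using pos[of "d i"] by (auto simp: \<sigma>_def neg neginv i)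
  next
    fix i assume "d i = 0"
    then show "\<sigma> i = i" using npos by (simp add: \<sigma>_def)
  qed
qed

section \<open>Anticommuting involutions of a diagonal matrix\<close>

text \<open>With every \<open>s i = 1\<close> this is a permutation matrix; the weights allow the sign
  change that corrects a determinant.\<close>

definition monomial_mat :: "nat \<Rightarrow> (nat \<Rightarrow> nat) \<Rightarrow> (nat \<Rightarrow> 'a :: zero) \<Rightarrow> 'a mat" where
  "monomial_mat n \<sigma> s = mat n n (\<lambda>(i, j). if j = \<sigma> i then s i else 0)"

lemma monomial_mat_carrier [simp]: "monomial_mat n \<sigma> s \<in> carrier_mat n n"
  by (simp add: monomial_mat_def)

lemma monomial_mat_mult_index:
  fixes A :: "'a :: comm_semiring_1 mat"
  assumes A: "A \<in> carrier_mat n n" and "i < n" "j < n" "\<sigma> i < n"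
  shows "(monomial_mat n \<sigma> s * A) $$ (i, j) = s i * A $$ (\<sigma> i, j)"
proof -
  have "(monomial_mat n \<sigma> s * A) $$ (i, j)
    = (\<Sum>l\<in>{0..<n}. (if l = \<sigma> i then s i else 0) * A $$ (l, j))"
    using assms by (simp add: monomial_mat_def scalar_prod_def)
  also have "\<dots> = (\<Sum>l\<in>{0..<n}. if l = \<sigma> i then s i * A $$ (\<sigma> i, j) else 0)"
    by (rule sum.cong) auto
  finally show ?thesis using assms by simp
qed

lemma monomial_mat_involution:
  fixes s :: "nat \<Rightarrow> 'a :: comm_semiring_1"
  assumes "\<And>i. i < n \<Longrightarrow> \<sigma> i < n" "\<And>i. i < n \<Longrightarrow> \<sigma> (\<sigma> i) = i"
    "\<And>i. i < n \<Longrightarrow> s i * s (\<sigma> i) = 1"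
  shows "monomial_mat n \<sigma> s * monomial_mat n \<sigma> s = 1\<^sub>m n"
proof (rule eq_matI)
  fix i j assume "i < dim_row (1\<^sub>m n :: 'a mat)" "j < dim_col (1\<^sub>m n :: 'a mat)"
  then have ij: "i < n" "j < n" by auto
  have "(monomial_mat n \<sigma> s * monomial_mat n \<sigma> s) $$ (i, j) = s i * monomial_mat n \<sigma> s $$ (\<sigma> i, j)"
    using ij assms by (intro monomial_mat_mult_index) auto
  then show "(monomial_mat n \<sigma> s * monomial_mat n \<sigma> s) $$ (i, j) = 1\<^sub>m n $$ (i, j)"
    using ij assms by (auto simp: monomial_mat_def)
qed (auto simp: monomial_mat_def)

lemma monomial_mat_anticommute:
  fixes D :: "'a :: comm_ring_1 mat"
  assumes D: "D \<in> carrier_mat n n" "diagonal_mat D"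
    and \<sigma>: "\<And>i. i < n \<Longrightarrow> \<sigma> i < n"
    and neg: "\<And>i. i < n \<Longrightarrow> D $$ (\<sigma> i, \<sigma> i) = - D $$ (i, i)"
  shows "monomial_mat n \<sigma> s * D = - (D * monomial_mat n \<sigma> s)"
proof (rule eq_matI)
  let ?M = "monomial_mat n \<sigma> s"
  fix i j assume "i < dim_row (- (D * ?M))" "j < dim_col (- (D * ?M))"
  then have ij: "i < n" "j < n" using D by (auto simp: monomial_mat_def)
  have "(D * ?M) $$ (i, j) = (\<Sum>l\<in>{0..<n}. D $$ (i, l) * ?M $$ (l, j))"
    using ij D by (simp add: scalar_prod_def monomial_mat_def)
  also have "\<dots> = (\<Sum>l\<in>{i}. D $$ (i, l) * ?M $$ (l, j))"
    using ij D by (intro sum.mono_neutral_right) (auto simp: diagonal_mat_def)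
  finally have DM: "(D * ?M) $$ (i, j) = D $$ (i, i) * ?M $$ (i, j)" by simp
  have "(?M * D) $$ (i, j) = s i * D $$ (\<sigma> i, j)"
    using ij D \<sigma> by (intro monomial_mat_mult_index) auto
  also have "\<dots> = - (D $$ (i, i) * ?M $$ (i, j))"
    using ij D \<sigma>[OF ij(1)] neg[OF ij(1)] by (auto simp: monomial_mat_def diagonal_mat_def)
  finally show "(?M * D) $$ (i, j) = (- (D * ?M)) $$ (i, j)"
    using DM ij D by (simp add: monomial_mat_def)
qed (use D in \<open>auto simp: monomial_mat_def\<close>)

lemma det_monomial_mat_flip_sign:
  fixes s :: "nat \<Rightarrow> 'a :: comm_ring_1"
  assumes "k < n"
  shows "det (monomial_mat n \<sigma> (s(k := - s k))) = - det (monomial_mat n \<sigma> s)"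
proof -
  have "monomial_mat n \<sigma> (s(k := - s k)) = multrow k (-1) (monomial_mat n \<sigma> s)"
    by (rule eq_matI) (auto simp: monomial_mat_def)
  then show ?thesis using det_multrow[OF assms monomial_mat_carrier, of "-1"] by simp
qed

text \<open>If \<open>D\<close> is invertible, the permutation matrix of a negating involution has determinant
  \<open>1\<close> because every anticommuting involution has determinant \<open>(-1)\<^bsup>n/2\<^esup>\<close>, where \<open>n\<close> is
  even and, by hypothesis, not \<open>2\<close> modulo \<open>4\<close>. If \<open>D\<close> is singular, a sign can be flipped at an index
  with diagonal entry \<open>0\<close>.\<close>

lemma diagonal_anticommuting_involution:
  fixes D :: "complex mat"
  assumes D: "D \<in> carrier_mat n n" "diagonal_mat D" and sim: "similar_mat (- D) D"
    and cond: "det D = 0 \<or> \<not> [n = 2] (mod 4)"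
  obtains M where "M \<in> carrier_mat n n" "M * M = 1\<^sub>m n" "M * D = - (D * M)" "det M = 1"
proof -
  define d where "d i = D $$ (i, i)" for i
  have "diagonal_mat (- D)" using D by (auto simp: diagonal_mat_def)
  then obtain f where f: "f permutes {..<n}" "\<And>i. i < n \<Longrightarrow> (- D) $$ (i, i) = D $$ (f i, f i)"
    using diagonal_similar_permutation[OF sim _ _ D(2), of n] D by auto
  have neg: "d (f i) = - d i" if "i \<in> {..<n}" for i
    using f(2)[of i] that D by (simp add: d_def)
  obtain \<sigma> where "\<And>i. i \<in> {..<n} \<Longrightarrow> \<sigma> i \<in> {..<n}" "\<And>i. i \<in> {..<n} \<Longrightarrow> \<sigma> (\<sigma> i) = i"
    "\<And>i. i \<in> {..<n} \<Longrightarrow> d (\<sigma> i) = - d i" and fixed: "\<And>i. d i = 0 \<Longrightarrow> \<sigma> i = i"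
    using negating_involution[of f "{..<n}" d, OF f(1) neg] by blast
  then have \<sigma>: "\<And>i. i < n \<Longrightarrow> \<sigma> i < n" "\<And>i. i < n \<Longrightarrow> \<sigma> (\<sigma> i) = i"
    "\<And>i. i < n \<Longrightarrow> D $$ (\<sigma> i, \<sigma> i) = - D $$ (i, i)"
    by (simp_all add: d_def)
  define M where "M = monomial_mat n \<sigma> (\<lambda>_. 1 :: complex)"
  have M: "M \<in> carrier_mat n n" "M * M = 1\<^sub>m n" "M * D = - (D * M)"
    unfolding M_def using \<sigma> monomial_mat_involution[of n \<sigma> "\<lambda>_. 1"]
      monomial_mat_anticommute[OF D \<sigma>(1,3)] by auto
  show ?thesis
  proof (cases "det D = 0")
    case False
    note inv = involution_trace_zero_det[OF M(1,2) anticommuting_trace_zero[OF M(1) D(1) M(3) False]]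
    have "n mod 4 \<noteq> 2" using cond False by (simp add: cong_def)
    then have "even (n div 2)" using inv(1) by presburger
    then show ?thesis using that[OF M] inv(2) by simp
  next
    case True
    have "det D = (\<Prod>i<n. d i)"
      using det_upper_triangular[of D n] D
      by (simp add: prod_list_diag_prod atLeast0LessThan d_def diagonal_mat_def upper_triangular_def)
    with True obtain k where k: "k < n" "d k = 0" by auto
    define N where "N = monomial_mat n \<sigma> ((\<lambda>_. 1 :: complex)(k := - 1))"
    \<comment> \<open>As \<open>\<sigma>\<close> fixes \<open>k\<close>, the weight \<open>-1\<close> at \<open>k\<close> is only ever multiplied with itself in \<open>N * N\<close>.\<close>
    have swap: "\<sigma> i = k \<longleftrightarrow> i = k" if "i < n" for i
      using \<sigma>(2)[OF that] fixed[OF k(2)] by auto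
    have N: "N \<in> carrier_mat n n" "N * D = - (D * N)"
      unfolding N_def using monomial_mat_anticommute[OF D \<sigma>(1,3)] by auto
    have NN: "N * N = 1\<^sub>m n"
      unfolding N_def using \<sigma>(1,2) swap by (intro monomial_mat_involution) auto
    have detN: "det N = - det M"
      unfolding N_def M_def using det_monomial_mat_flip_sign[OF k(1), of \<sigma> "\<lambda>_. 1"] by simp
    \<comment> \<open>Involutions have determinant \<open>1\<close> or \<open>-1\<close>, so one of \<open>M\<close> and \<open>N\<close> has determinant \<open>1\<close>.\<close>
    have "det M * det M = 1" using det_mult[OF M(1) M(1)] M(2) by simp
    then consider "det M = 1" | "det N = 1" using detN by (auto simp: square_eq_1_iff)
    then show ?thesis by cases (use that M N NN in auto)
  qed
qed

section \<open>Strong reality of semisimple elements\<close>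

lemma eigenvalue_0_iff_det:
  fixes A :: "'a :: field mat"
  assumes A: "A \<in> carrier_mat n n"
  shows "eigenvalue A 0 \<longleftrightarrow> det A = 0"
proof -
  have "char_matrix A 0 = A" using A by (intro eq_matI) (auto simp: char_matrix_def)
  then show ?thesis by (simp add: eigenvalue_det[OF A])
qed

lemma similar_mat_uminus:
  fixes A B :: "'a :: comm_ring_1 mat"
  assumes "similar_mat A B"
  shows "similar_mat (- A) (- B)"
proof -
  from similar_matD[OF assms] obtain n P Q where
    c: "A \<in> carrier_mat n n" "B \<in> carrier_mat n n" "P \<in> carrier_mat n n" "Q \<in> carrier_mat n n"
    and PQ: "P * Q = 1\<^sub>m n" "Q * P = 1\<^sub>m n" and A: "A = P * B * Q"
    by auto
  have "- A = P * (- B) * Q" unfolding A using c by simp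
  then show ?thesis using c PQ by (intro similar_matI[of _ _ P Q n]) auto
qed

lemma Ad_real_similar_uminus:
  assumes X: "X \<in> carrier_mat n n" and "Ad_real (GL n) X"
  shows "similar_mat (- X) X"
proof -
  obtain g where g: "g \<in> GL n" and eq: "- X = Ad g X" using assms by (auto simp: Ad_real_def)
  then have gc: "g \<in> carrier_mat n n" by (simp add: GL_def)
  obtain h where h: "h \<in> carrier_mat n n" "g * h = 1\<^sub>m n" "h * g = 1\<^sub>m n"
    using GL_inverse[OF g] .
  show ?thesis
    using Ad_eq[OF gc h] eq X gc h by (intro similar_matI[of _ _ g h n]) auto
qed

theorem theorem3p5:
  fixes n :: nat and H :: "complex mat"
  assumes "n > 0"
    and "H \<in> sl n"
    and "semisimple H"
    and "Ad_real (SL n) H"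
  shows "strongly_Ad_real (SL n) H \<longleftrightarrow> eigenvalue H 0 \<or> \<not> [n = 2] (mod 4)"
proof -
  have H: "H \<in> carrier_mat n n" using assms(2) by (simp add: sl_def)
  show ?thesis
    unfolding strongly_Ad_real_SL_iff[OF H] eigenvalue_0_iff_det[OF H]
  proof
    assume "\<exists>\<tau>\<in>carrier_mat n n. det \<tau> = 1 \<and> \<tau> * \<tau> = 1\<^sub>m n \<and> \<tau> * H = - (H * \<tau>)"
    then obtain \<tau> where \<tau>: "\<tau> \<in> carrier_mat n n" "det \<tau> = 1" "\<tau> * \<tau> = 1\<^sub>m n"
      "\<tau> * H = - (H * \<tau>)" by blast
    show "det H = 0 \<or> \<not> [n = 2] (mod 4)"
    proof (cases "det H = 0")
      case False
      then have "det \<tau> = (-1) ^ (n div 2)"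
        using involution_trace_zero_det(2)[OF \<tau>(1,3)] anticommuting_trace_zero[OF \<tau>(1) H \<tau>(4)]
        by blast
      then have "even (n div 2)"
        using \<tau>(2) by (cases "even (n div 2)") auto
      then have "n mod 4 \<noteq> 2" by presburger
      then show ?thesis by (simp add: cong_def)
    qed simp
  next
    assume cond: "det H = 0 \<or> \<not> [n = 2] (mod 4)"
    obtain D P Q where D: "diagonal_mat D" and wit: "similar_mat_wit H D P Q"
      using assms(3) by (auto simp: semisimple_def similar_mat_def)
    note w = similar_mat_witD2[OF H wit]
    have sim: "similar_mat H D" using wit by (auto simp: similar_mat_def)
    have "similar_mat (- H) H"
      using assms(4) by (intro Ad_real_similar_uminus[OF H]) (auto simp: Ad_real_def SL_def)
    then have simD: "similar_mat (- D) D"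
      using similar_mat_uminus[OF sim] sim similar_mat_sym similar_mat_trans by metis
    obtain M where M: "M \<in> carrier_mat n n" "M * M = 1\<^sub>m n" "M * D = - (D * M)" "det M = 1"
      using diagonal_anticommuting_involution[OF w(5) D simD] cond det_similar[OF sim] by metis
    note conj = conj_mult_mat[OF w(6) _ _ w(7) w(2)]
    define \<tau> where "\<tau> = P * M * Q"
    have "\<tau> \<in> carrier_mat n n" using w M by (simp add: \<tau>_def)
    moreover have "det \<tau> = 1"
    proof -
      have "similar_mat \<tau> M"
        using w M \<tau>_def by (intro similar_matI[of _ _ P Q n]) auto
      then show ?thesis using det_similar M(4) by metis
    qed
    moreover have "\<tau> * \<tau> = 1\<^sub>m n"
      unfolding \<tau>_def conj[OF M(1) M(1)] M(2) using w by simp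
    moreover have "\<tau> * H = - (H * \<tau>)"
      unfolding \<tau>_def w(3) conj[OF M(1) w(5)] conj[OF w(5) M(1)] M(3) using w M by simp
    ultimately show "\<exists>\<tau>\<in>carrier_mat n n. det \<tau> = 1 \<and> \<tau> * \<tau> = 1\<^sub>m n \<and> \<tau> * H = - (H * \<tau>)"
      by blast
  qed
qed

end
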